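(* Let $t \geq 2$ be an integer and let $G$ be a connected graph with $n$ vertices, minimum degree $\delta(G)$, and spectral radius $\rho(G)$. Then $$\pi_t(G)\geq\rho(G)+(n-t+1)\left\lceil\frac{\delta(G)}{t-1}\right\rceil,$$ with equality if and only if $G$ is regular and has a $K_t$-decomposition.
   Context: Graphs are finite, simple and undirected. The spectral radius $\rho(G)$ is the largest eigenvalue of the adjacency matrix of $G$. A clique in $G$ is a vertex set $Q\subseteq V(G)$ such that the subgraph induced on $Q$ is complete. A clique partition of $G$ is a set $\mathcal{Q}=\{Q_1,\ldots,Q_m\}$ of cliques such that each edge of $G$ belongs to exactly one clique of $\mathcal{Q}$ (for an edgeless graph the empty set is a clique partition). The total size of $\mathcal{Q}$ is $s(\mathcal{Q})=\sum_{i=1}^m|Q_i|$. $\pi_t(G)$ denotes the minimum of $s(\mathcal{Q})$ over all clique partitions $\mathcal{Q}$ of $G$ in which every clique has at most $t$ vertices. A $K_t$-decomposition of $G$ is a clique partition of $G$ in which every clique has exactly $t$ vertices. *)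

theory Defs
  imports
    "Jordan_Normal_Form.Spectral_Radius"
    "Graph_Theory.Digraph_Component"
    "Graph_Theory.Kuratowski"
begin

text \<open>
  Finite simple undirected graphs are the locale \<open>graph\<close> of \<open>Graph_Theory\<close>: finite loopless
  digraphs without parallel arcs whose arc relation is symmetric. An undirected edge \<open>uv\<close> is thus
  the pair of arcs \<open>(u, v)\<close>, \<open>(v, u)\<close>, and the degree of a vertex is its out-degree.
\<close>

definition min_degree :: "('a, 'b) pre_digraph \<Rightarrow> nat" where
  "min_degree G = Min (out_degree G ` verts G)"

definition regular_graph :: "('a, 'b) pre_digraph \<Rightarrow> bool" where
  "regular_graph G \<longleftrightarrow> (\<exists>d. \<forall>v\<in>verts G. out_degree G v = d)"

definition adjacency_matrix :: "('a, 'b) pre_digraph \<Rightarrow> 'a list \<Rightarrow> real mat" where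
  "adjacency_matrix G vs =
     mat (length vs) (length vs) (\<lambda>(i, j). if vs ! i \<rightarrow>\<^bsub>G\<^esub> vs ! j then 1 else 0)"

text \<open>
  The largest real eigenvalue of the adjacency matrix. The choice of the enumeration is
  immaterial, see \<open>graph_spectral_radius_eq\<close> below.
\<close>

definition graph_spectral_radius :: "('a, 'b) pre_digraph \<Rightarrow> real" where
  "graph_spectral_radius G =
     Max (spectrum (adjacency_matrix G (SOME vs. distinct vs \<and> set vs = verts G)))"

lemma eigenvalue_adjacency_matrix_iff:
  assumes vs: "distinct vs" "set vs = verts G"
  shows "eigenvalue (adjacency_matrix G vs) k \<longleftrightarrow>
    (\<exists>f. (\<exists>v\<in>verts G. f v \<noteq> 0) \<and>
         (\<forall>v\<in>verts G. (\<Sum>w\<in>verts G. if v \<rightarrow>\<^bsub>G\<^esub> w then f w else 0) = k * f v))"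
    (is "?L \<longleftrightarrow> (\<exists>f. ?R f)")
proof -
  let ?n = "length vs" and ?A = "adjacency_matrix G vs"
  have bij: "bij_betw ((!) vs) {..<?n} (verts G)"
    using bij_betw_nth[OF vs(1) refl] vs(2) by blast
  have row: "(?A *\<^sub>v x) $ i = (\<Sum>w\<in>verts G. if vs ! i \<rightarrow>\<^bsub>G\<^esub> w then f w else 0)"
    if i: "i < ?n" and x: "x \<in> carrier_vec ?n" and f: "\<And>j. j < ?n \<Longrightarrow> x $ j = f (vs ! j)"
    for x i f
  proof -
    have "(?A *\<^sub>v x) $ i = (\<Sum>j\<in>{..<?n}. if vs ! i \<rightarrow>\<^bsub>G\<^esub> vs ! j then f (vs ! j) else 0)"
      using i x f
      by (auto simp: adjacency_matrix_def scalar_prod_def lessThan_atLeast0 intro!: sum.cong)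
    also have "\<dots> = (\<Sum>w\<in>verts G. if vs ! i \<rightarrow>\<^bsub>G\<^esub> w then f w else 0)"
      using sum.reindex_bij_betw[OF bij, of "\<lambda>w. if vs ! i \<rightarrow>\<^bsub>G\<^esub> w then f w else 0"] by simp
    finally show ?thesis .
  qed
  have dim: "dim_row ?A = ?n" by (simp add: adjacency_matrix_def)
  show ?thesis
  proof
    assume ?L
    then obtain x where x: "x \<in> carrier_vec ?n" "x \<noteq> 0\<^sub>v ?n" "?A *\<^sub>v x = k \<cdot>\<^sub>v x"
      unfolding eigenvalue_def eigenvector_def dim by blast
    define f where "f = (\<lambda>v. x $ (inv_into {..<?n} ((!) vs) v))"
    have f: "x $ j = f (vs ! j)" if "j < ?n" for j
      using that bij by (simp add: f_def bij_betw_def inv_into_f_f)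
    obtain i where "i < ?n" "x $ i \<noteq> 0"
      using x(1,2) by (metis carrier_vecD eq_vecI index_zero_vec(1) index_zero_vec(2))
    then have "\<exists>v\<in>verts G. f v \<noteq> 0" using f vs(2) nth_mem by metis
    moreover have "(\<Sum>w\<in>verts G. if v \<rightarrow>\<^bsub>G\<^esub> w then f w else 0) = k * f v" if v: "v \<in> verts G" for v
    proof -
      obtain i where i: "i < ?n" "v = vs ! i" using v vs(2) by (metis in_set_conv_nth)
      show ?thesis using row[OF i(1) x(1) f] x i f by simp
    qed
    ultimately show "\<exists>f. ?R f" by blast
  next
    assume "\<exists>f. ?R f"
    then obtain f where f: "?R f" by blast
    define x where "x = vec ?n (\<lambda>i. f (vs ! i))"
    have x: "x \<in> carrier_vec ?n" by (simp add: x_def)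
    obtain v where "v \<in> verts G" "f v \<noteq> 0" using f by blast
    then obtain i where i: "i < ?n" "f (vs ! i) \<noteq> 0" using vs(2) by (metis in_set_conv_nth)
    then have "x $ i \<noteq> 0\<^sub>v ?n $ i" by (simp add: x_def)
    then have "x \<noteq> 0\<^sub>v ?n" by metis
    moreover have "?A *\<^sub>v x = k \<cdot>\<^sub>v x"
    proof (rule eq_vecI)
      show "dim_vec (?A *\<^sub>v x) = dim_vec (k \<cdot>\<^sub>v x)" using dim x by simp
      fix i assume "i < dim_vec (k \<cdot>\<^sub>v x)"
      then have i: "i < ?n" using x by simp
      then have "vs ! i \<in> verts G" using vs(2) nth_mem by blast
      then show "(?A *\<^sub>v x) $ i = (k \<cdot>\<^sub>v x) $ i"
        using row[OF i x, of f] f i by (simp add: x_def)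
    qed
    ultimately show ?L using x unfolding eigenvalue_def eigenvector_def dim by blast
  qed
qed

lemma graph_spectral_radius_eq:
  assumes "distinct vs" "set vs = verts G"
  shows "graph_spectral_radius G = Max (spectrum (adjacency_matrix G vs))"
proof -
  let ?P = "\<lambda>vs. distinct vs \<and> set vs = verts G"
  have "?P (SOME vs. ?P vs)" using assms by (intro someI[of ?P]) simp
  then have "eigenvalue (adjacency_matrix G (SOME vs. ?P vs)) = eigenvalue (adjacency_matrix G vs)"
    using assms by (intro ext) (simp add: eigenvalue_adjacency_matrix_iff)
  then show ?thesis unfolding graph_spectral_radius_def spectrum_def by simp
qed

definition clique :: "('a, 'b) pre_digraph \<Rightarrow> 'a set \<Rightarrow> bool" where
  "clique G Q \<longleftrightarrow> Q \<subseteq> verts G \<and> complete_digraph (card Q) (G \<restriction> Q)"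

definition clique_partition :: "('a, 'b) pre_digraph \<Rightarrow> 'a set set \<Rightarrow> bool" where
  "clique_partition G P \<longleftrightarrow>
     (\<forall>Q\<in>P. clique G Q) \<and> (\<forall>u v. u \<rightarrow>\<^bsub>G\<^esub> v \<longrightarrow> (\<exists>!Q. Q \<in> P \<and> {u, v} \<subseteq> Q))"

definition total_size :: "'a set set \<Rightarrow> nat" where
  "total_size P = (\<Sum>Q\<in>P. card Q)"

definition min_total_size :: "nat \<Rightarrow> ('a, 'b) pre_digraph \<Rightarrow> nat" where
  "min_total_size t G =
     Min (total_size ` {P. clique_partition G P \<and> (\<forall>Q\<in>P. card Q \<le> t)})"

text \<open>For \<open>t \<ge> 2\<close> the minimum above is attained: its index set is finite and nonempty.\<close>

lemma min_total_size_index_set: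
  assumes "graph G" "t \<ge> 2"
  defines "I \<equiv> {P. clique_partition G P \<and> (\<forall>Q\<in>P. card Q \<le> t)}"
  shows "finite I" "I \<noteq> {}"
proof -
  interpret graph G by fact
  have "I \<subseteq> Pow (Pow (verts G))"
    unfolding I_def clique_partition_def clique_def by blast
  then show "finite I" by (rule finite_subset) simp
  let ?P = "{{u, v} | u v. u \<rightarrow>\<^bsub>G\<^esub> v}"
  have neq: "u \<noteq> v" if "u \<rightarrow>\<^bsub>G\<^esub> v" for u v
    using that no_loops by (auto simp: arcs_ends_conv)
  have clq: "clique G {u, v}" if uv: "u \<rightarrow>\<^bsub>G\<^esub> v" for u v
  proof -
    have vu: "v \<rightarrow>\<^bsub>G\<^esub> u" using uv sym_arcs by (auto simp: symmetric_def dest: symD)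
    have sub: "{u, v} \<subseteq> verts G" using uv by auto
    have ends: "arcs_ends (G \<restriction> {u, v}) = {(x, y). x \<rightarrow>\<^bsub>G\<^esub> y \<and> x \<in> {u, v} \<and> y \<in> {u, v}}"
      unfolding arcs_ends_conv induce_subgraph_def by auto
    have eq: "arcs_ends (G \<restriction> {u, v}) = {(x, y). (x, y) \<in> {u, v} \<times> {u, v} \<and> x \<noteq> y}"
      unfolding ends using uv vu neq by auto
    have "digraph (G \<restriction> {u, v})" using sub by (intro digraphI_induced induced_induce)
    then have "graph (G \<restriction> {u, v})"
      by (rule digraph.graphI) (auto simp: symmetric_def eq sym_def)
    then show ?thesis using sub eq by (simp add: clique_def complete_digraph_def)
  qed
  have "clique_partition G ?P"
    unfolding clique_partition_def
  proof (intro conjI allI impI ballI)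
    show "clique G Q" if "Q \<in> ?P" for Q using that clq by blast
    fix u v assume uv: "u \<rightarrow>\<^bsub>G\<^esub> v"
    show "\<exists>!Q. Q \<in> ?P \<and> {u, v} \<subseteq> Q"
    proof (rule ex1I[of _ "{u, v}"])
      show "{u, v} \<in> ?P \<and> {u, v} \<subseteq> {u, v}" using uv by blast
      fix Q assume "Q \<in> ?P \<and> {u, v} \<subseteq> Q"
      then show "Q = {u, v}" using neq[OF uv] by auto
    qed
  qed
  moreover have "card Q \<le> t" if "Q \<in> ?P" for Q
    using that assms(2) by (auto simp: card_insert_if)
  ultimately show "I \<noteq> {}" unfolding I_def by blast
qed

definition has_K_decomposition :: "nat \<Rightarrow> ('a, 'b) pre_digraph \<Rightarrow> bool" where
  "has_K_decomposition t G \<longleftrightarrow> (\<exists>P. clique_partition G P \<and> (\<forall>Q\<in>P. card Q = t))"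

end

theory Submission
  imports Defs
begin

text \<open>
  Take an optimal partition \<open>P\<close>, let \<open>p v\<close> be the number of its cliques containing \<open>v\<close>, and let
  \<open>c = \<lceil>\<delta> / (t - 1)\<rceil>\<close>, so that \<open>p v \<ge> c\<close>. For an eigenvector \<open>f\<close> of eigenvalue \<open>\<rho>\<close>, the clique sums
  \<open>y Q = (\<Sum>w\<in>Q. f w)\<close> satisfy \<open>(\<Sum>Q\<ni>v. y Q) = (p v + \<rho>) f v\<close>. Summing absolute values over a clique \<open>Q\<close>
  that maximises \<open>\<bar>y Q\<bar>\<close> gives \<open>c + \<rho> \<le> (\<Sum>v\<in>Q. p v)\<close>; the other vertices, at least \<open>n - t\<close> many,
  contribute at least \<open>c\<close> each to the total size \<open>(\<Sum>v. p v)\<close>, which is the bound. In case of equality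
  every clique meeting \<open>Q\<close> is again maximal, so by connectedness all cliques are maximal; hence all
  of them have \<open>t\<close> vertices, and \<open>p\<close> is constantly \<open>c\<close>. No sign condition on \<open>f\<close> is needed, so
  Perron--Frobenius theory is avoided.
\<close>

section \<open>Existence of a real eigenvalue\<close>

text \<open>Ensures that the \<open>Max\<close> defining the spectral radius is taken over a
  nonempty set. A complex eigenvalue exists, and symmetry makes it real.\<close>

lemma real_symmetric_spectrum_nonempty:
  fixes A :: "real mat"
  assumes A: "A \<in> carrier_mat n n" and n: "n > 0"
    and sym: "\<And>i j. i < n \<Longrightarrow> j < n \<Longrightarrow> A $$ (i, j) = A $$ (j, i)"
  shows "spectrum A \<noteq> {}"
proof -
  define C :: "complex mat" where "C = map_mat of_real A"
  have C: "C \<in> carrier_mat n n" using A by (simp add: C_def)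
  obtain k where k: "eigenvalue C k"
    using spectrum_non_empty[OF C n] by (auto simp: spectrum_def)
  then obtain z where z: "z \<in> carrier_vec n" "z \<noteq> 0\<^sub>v n" "C *\<^sub>v z = k \<cdot>\<^sub>v z"
    using C unfolding eigenvalue_def eigenvector_def by auto
  have row: "(\<Sum>j<n. of_real (A $$ (i, j)) * z $ j) = k * z $ i" if i: "i < n" for i
  proof -
    have "(C *\<^sub>v z) $ i = (\<Sum>j<n. of_real (A $$ (i, j)) * z $ j)"
      using i z(1) A by (auto simp: C_def scalar_prod_def lessThan_atLeast0 intro!: sum.cong)
    then show ?thesis using z i by simp
  qed
  \<comment> \<open>\<open>S\<close> is the Hermitian form of \<open>A\<close> at \<open>z\<close>
    and \<open>N\<close> the squared norm of \<open>z\<close>. From \<open>S = k * N\<close>,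
    \<open>cnj S = S\<close> and \<open>N > 0\<close> it follows that \<open>k\<close> is
    real.\<close>
  define S where "S = (\<Sum>i<n. \<Sum>j<n. of_real (A $$ (i, j)) * cnj (z $ i) * z $ j)"
  define N where "N = (\<Sum>i<n. (cmod (z $ i))\<^sup>2)"
  have "S = (\<Sum>i<n. cnj (z $ i) * (k * z $ i))"
    unfolding S_def
  proof (intro sum.cong refl)
    fix i assume "i \<in> {..<n}"
    then have "k * z $ i = (\<Sum>j<n. of_real (A $$ (i, j)) * z $ j)" by (simp add: row)
    then show "(\<Sum>j<n. of_real (A $$ (i, j)) * cnj (z $ i) * z $ j) = cnj (z $ i) * (k * z $ i)"
      by (simp only: sum_distrib_left mult_ac)
  qed
  also have "\<dots> = k * of_real N"
    unfolding N_def of_real_sum sum_distrib_left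
    by (intro sum.cong refl)
      (simp add: complex_norm_square[symmetric] mult.commute mult.left_commute del: of_real_power)
  finally have SN: "S = k * of_real N" .
  have "cnj S = (\<Sum>i<n. \<Sum>j<n. of_real (A $$ (j, i)) * cnj (z $ j) * z $ i)"
    unfolding S_def by (auto simp: sym algebra_simps intro!: sum.cong)
  also have "\<dots> = S" unfolding S_def by (rule sum.swap)
  finally have "cnj k * of_real N = k * of_real N" using SN by simp
  moreover have "N > 0"
  proof -
    obtain i where i: "i < n" "z $ i \<noteq> 0"
      using z(1,2) by (metis carrier_vecD eq_vecI index_zero_vec(1) index_zero_vec(2))
    then show ?thesis unfolding N_def by (intro sum_pos2[of _ i]) auto
  qed
  ultimately have "cnj k = k" by simp
  then have kr: "k = of_real (Re k)" by (simp add: complex_eq_iff)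
  \<comment> \<open>The eigenvector \<open>z\<close> may be non-real, so the descent to
    \<open>A\<close> goes through the characteristic polynomial, whose coefficients are
    real.\<close>
  have "poly (char_poly C) k = 0" using k eigenvalue_root_char_poly[OF C] by simp
  then have "poly (map_poly of_real (char_poly A)) (of_real (Re k) :: complex) = 0"
    using of_real_hom.char_poly_hom[OF A] kr unfolding C_def by metis
  then have "poly (char_poly A) (Re k) = 0" by simp
  then show ?thesis using eigenvalue_root_char_poly[OF A] by (auto simp: spectrum_def)
qed

section \<open>Eigenvalues and degrees as sums over neighbours\<close>

context graph
begin

lemma dominates_sym: "u \<rightarrow>\<^bsub>G\<^esub> v \<Longrightarrow> v \<rightarrow>\<^bsub>G\<^esub> u"
  using sym_arcs by (auto simp: symmetric_def dest: symD)

text \<open>Replaces vectors over an enumeration by functions on vertices. The spectrum is finite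
  and nonempty, so its \<open>Max\<close> is attained and dominates every real eigenvalue.\<close>

lemma graph_eigenvalue_spectral_radius:
  assumes "verts G \<noteq> {}"
  shows "\<exists>f. (\<exists>v\<in>verts G. f v \<noteq> 0) \<and>
    (\<forall>v\<in>verts G. (\<Sum>w\<in>verts G. if v \<rightarrow>\<^bsub>G\<^esub> w then f w else 0) = graph_spectral_radius G * f v)"
    (is ?ex)
  and "\<lbrakk>\<exists>v\<in>verts G. f v \<noteq> 0;
    \<And>v. v \<in> verts G \<Longrightarrow> (\<Sum>w\<in>verts G. if v \<rightarrow>\<^bsub>G\<^esub> w then f w else 0) = k * f v\<rbrakk>
    \<Longrightarrow> k \<le> graph_spectral_radius G"
proof -
  obtain vs where vs: "distinct vs" "set vs = verts G"
    using finite_distinct_list[OF finite_verts] by blast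
  let ?A = "adjacency_matrix G vs"
  have A: "?A \<in> carrier_mat (length vs) (length vs)" by (simp add: adjacency_matrix_def)
  have fin: "finite (spectrum ?A)" using card_finite_spectrum[OF A] by simp
  have "spectrum ?A \<noteq> {}"
    using assms vs
    by (intro real_symmetric_spectrum_nonempty[OF A])
      (auto simp: adjacency_matrix_def dest: dominates_sym)
  then have "graph_spectral_radius G \<in> spectrum ?A"
    unfolding graph_spectral_radius_eq[OF vs] using fin by (rule Max_in[rotated])
  then show ?ex
    unfolding spectrum_def by (simp add: eigenvalue_adjacency_matrix_iff[OF vs])
  assume "\<exists>v\<in>verts G. f v \<noteq> 0"
    "\<And>v. v \<in> verts G \<Longrightarrow> (\<Sum>w\<in>verts G. if v \<rightarrow>\<^bsub>G\<^esub> w then f w else 0) = k * f v"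
  then have "k \<in> spectrum ?A"
    unfolding spectrum_def by (auto simp: eigenvalue_adjacency_matrix_iff[OF vs])
  then show "k \<le> graph_spectral_radius G"
    unfolding graph_spectral_radius_eq[OF vs] using fin by simp
qed

text \<open>Out-degree counts arcs; without parallel arcs, taking heads is injective on the arcs
  leaving \<open>v\<close>.\<close>

lemma out_degree_eq_card_neighbours: "out_degree G v = card {w \<in> verts G. v \<rightarrow>\<^bsub>G\<^esub> w}"
proof -
  have "inj_on (head G) (out_arcs G v)"
    by (rule inj_onI) (auto simp: out_arcs_def arc_to_ends_def intro: no_multi_arcs)
  moreover have "head G ` out_arcs G v = {w \<in> verts G. v \<rightarrow>\<^bsub>G\<^esub> w}"
    by (auto simp: out_arcs_def arcs_ends_conv)
  ultimately show ?thesis unfolding out_degree_def by (metis card_image)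
qed

lemma out_degree_sum: "real (out_degree G v) = (\<Sum>w\<in>verts G. if v \<rightarrow>\<^bsub>G\<^esub> w then 1 else 0)"
  unfolding out_degree_eq_card_neighbours by (simp add: sum.If_cases Int_def)

lemma clique_dominates:
  assumes "clique G Q" "u \<in> Q" "v \<in> Q" "u \<noteq> v"
  shows "u \<rightarrow>\<^bsub>G\<^esub> v"
proof -
  have "(u, v) \<in> arcs_ends (G \<restriction> Q)"
    using assms unfolding clique_def complete_digraph_def by auto
  then show ?thesis unfolding arcs_ends_conv induce_subgraph_def by auto
qed

end

section \<open>Counting in a clique partition\<close>

locale clique_partitioned_graph = graph G for G :: "('a, 'b) pre_digraph" +
  fixes P :: "'a set set"
  assumes partition: "clique_partition G P"
begin

text \<open>The number \<open>p v\<close> of the overview.\<close>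

definition multiplicity :: "'a \<Rightarrow> nat" where
  "multiplicity v = card {Q \<in> P. v \<in> Q}"

lemma clique_subset: "Q \<in> P \<Longrightarrow> Q \<subseteq> verts G"
  using partition by (auto simp: clique_partition_def clique_def)

lemma finite_clique: "Q \<in> P \<Longrightarrow> finite Q"
  using clique_subset finite_subset finite_verts by blast

lemma finite_partition: "finite P"
  using clique_subset finite_verts by (meson Pow_iff finite_Pow_iff finite_subset subsetI)

text \<open>Supplies the off-diagonal entries of the identity below: an edge lies in exactly one
  clique of \<open>P\<close>, and distinct vertices of a common clique are adjacent.\<close>

lemma card_common_cliques:
  assumes "v \<noteq> w"
  shows "card {Q \<in> P. v \<in> Q \<and> w \<in> Q} = (if v \<rightarrow>\<^bsub>G\<^esub> w then 1 else 0)"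
proof (cases "v \<rightarrow>\<^bsub>G\<^esub> w")
  case True
  then have "\<exists>!Q. Q \<in> P \<and> {v, w} \<subseteq> Q" using partition by (auto simp: clique_partition_def)
  then obtain Q where "{Q \<in> P. v \<in> Q \<and> w \<in> Q} = {Q}" by auto
  then show ?thesis using True by simp
next
  case False
  then have "{Q \<in> P. v \<in> Q \<and> w \<in> Q} = {}"
    using partition clique_dominates assms by (auto simp: clique_partition_def)
  then show ?thesis using False by (metis card.empty)
qed

text \<open>The entrywise form of \<open>M M\<^sup>T = A + D\<close>, where \<open>M\<close> is the vertex-clique incidence matrix,
  \<open>A\<close> the adjacency matrix and \<open>D\<close> the diagonal matrix of multiplicities.\<close>

lemma sum_over_containing_cliques:
  fixes f :: "'a \<Rightarrow> real"
  assumes v: "v \<in> verts G"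
  shows "(\<Sum>Q | Q \<in> P \<and> v \<in> Q. sum f Q) =
    multiplicity v * f v + (\<Sum>w\<in>verts G. if v \<rightarrow>\<^bsub>G\<^esub> w then f w else 0)"
proof -
  let ?Pv = "{Q \<in> P. v \<in> Q}"
  have "(\<Sum>Q\<in>?Pv. sum f Q) = (\<Sum>Q\<in>?Pv. \<Sum>w\<in>verts G. if w \<in> Q then f w else 0)"
    using clique_subset
    by (auto simp: sum.inter_restrict[symmetric] Int_absorb1 intro!: sum.cong[OF refl])
  also have "\<dots> = (\<Sum>w\<in>verts G. \<Sum>Q\<in>?Pv. if w \<in> Q then f w else 0)"
    by (rule sum.swap)
  also have "\<dots> = (\<Sum>w\<in>verts G. card {Q \<in> P. v \<in> Q \<and> w \<in> Q} * f w)"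
    using finite_partition by (intro sum.cong refl) (simp add: sum.If_cases Int_def conj_assoc)
  \<comment> \<open>The term \<open>w = v\<close> counts all cliques through \<open>v\<close>; since
    no vertex is adjacent to itself, it does not mix with the neighbour terms.\<close>
  also have "\<dots> = (\<Sum>w\<in>verts G. (if w = v then multiplicity v * f v else 0)
      + (if v \<rightarrow>\<^bsub>G\<^esub> w then f w else 0))"
  proof (intro sum.cong refl)
    fix w
    show "card {Q \<in> P. v \<in> Q \<and> w \<in> Q} * f w = (if w = v then multiplicity v * f v else 0)
      + (if v \<rightarrow>\<^bsub>G\<^esub> w then f w else 0)"
      using card_common_cliques[of v w] adj_not_same[of v] by (auto simp: multiplicity_def)
  qed
  also have "\<dots> = multiplicity v * f v + (\<Sum>w\<in>verts G. if v \<rightarrow>\<^bsub>G\<^esub> w then f w else 0)"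
    using v by (simp add: sum.distrib)
  finally show ?thesis by simp
qed

text \<open>The incidence identity for the constant function 1, whose neighbour sum is the
  degree.\<close>

lemma sum_card_containing_cliques:
  assumes "v \<in> verts G"
  shows "(\<Sum>Q | Q \<in> P \<and> v \<in> Q. card Q) = multiplicity v + out_degree G v"
proof -
  have "real (\<Sum>Q | Q \<in> P \<and> v \<in> Q. card Q) = multiplicity v + out_degree G v"
    using sum_over_containing_cliques[OF assms, of "\<lambda>_. 1"] by (simp add: out_degree_sum)
  then show ?thesis by linarith
qed

text \<open>Each clique through \<open>v\<close> has at most \<open>t - 1\<close> further vertices;
  the additive form avoids subtraction of naturals.\<close>

lemma out_degree_le_multiplicity:
  assumes "v \<in> verts G" "\<And>Q. Q \<in> P \<Longrightarrow> card Q \<le> t"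
  shows "multiplicity v + out_degree G v \<le> multiplicity v * t"
proof -
  have "(\<Sum>Q | Q \<in> P \<and> v \<in> Q. card Q) \<le> (\<Sum>Q | Q \<in> P \<and> v \<in> Q. t)"
    using assms by (intro sum_mono) auto
  then show ?thesis using sum_card_containing_cliques[OF assms(1)] by (simp add: multiplicity_def)
qed

lemma out_degree_eq_multiplicity:
  assumes "v \<in> verts G" "\<And>Q. Q \<in> P \<Longrightarrow> card Q = t"
  shows "multiplicity v + out_degree G v = multiplicity v * t"
  using sum_card_containing_cliques[OF assms(1)] assms(2) by (simp add: multiplicity_def)

text \<open>Vertex-clique incidences, counted from either side.\<close>

lemma total_size_eq_sum_multiplicity: "total_size P = sum multiplicity (verts G)"
proof -
  have "total_size P = (\<Sum>Q\<in>P. \<Sum>v | v \<in> verts G \<and> v \<in> Q. 1)"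
    unfolding total_size_def using clique_subset
    by (intro sum.cong refl) (auto intro!: arg_cong[of _ _ card])
  also have "\<dots> = (\<Sum>v\<in>verts G. \<Sum>Q | Q \<in> P \<and> v \<in> Q. 1)"
    by (rule sum.swap_restrict[OF finite_partition finite_verts])
  finally show ?thesis by (simp add: multiplicity_def)
qed

text \<open>The multiplicity is an integer, which is why the quotient may be rounded up.\<close>

lemma multiplicity_ge_ceiling:
  assumes "t \<ge> 2" "v \<in> verts G" "\<And>Q. Q \<in> P \<Longrightarrow> card Q \<le> t"
  shows "\<lceil>real (min_degree G) / (real t - 1)\<rceil> \<le> int (multiplicity v)"
proof -
  have "min_degree G \<le> out_degree G v"
    unfolding min_degree_def using assms(2) by (intro Min_le) auto
  then have "multiplicity v + min_degree G \<le> multiplicity v * t"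
    using out_degree_le_multiplicity[OF assms(2,3)] by simp
  then have "real (multiplicity v + min_degree G) \<le> real (multiplicity v * t)"
    by (rule of_nat_mono)
  then have "real (min_degree G) / (real t - 1) \<le> multiplicity v"
    using assms(1) by (simp add: divide_simps algebra_simps)
  then show ?thesis by (simp add: ceiling_le_iff)
qed

section \<open>The eigenvector at a clique of maximal absolute sum\<close>

text \<open>Later \<open>k\<close> is the spectral radius and \<open>c\<close> the rounded quotient.
  The condition \<open>c + k > 0\<close> lets coefficients be pulled out of absolute values; the
  opposite sign is handled in \<open>total_size_bound\<close>.\<close>

context
  fixes f :: "'a \<Rightarrow> real" and k :: real and c :: nat
  assumes eigen: "\<And>v. v \<in> verts G \<Longrightarrow>
      (\<Sum>w\<in>verts G. if v \<rightarrow>\<^bsub>G\<^esub> w then f w else 0) = k * f v"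
    and mult_ge: "\<And>v. v \<in> verts G \<Longrightarrow> c \<le> multiplicity v"
    and c_pos: "1 \<le> c" and ck_pos: "c + k > 0"
begin

lemma eigen_clique_sum:
  assumes "v \<in> verts G"
  shows "(\<Sum>Q | Q \<in> P \<and> v \<in> Q. sum f Q) = (multiplicity v + k) * f v"
  using sum_over_containing_cliques[OF assms, of f] eigen[OF assms] by (simp add: algebra_simps)

context
  fixes Q0
  assumes Q0: "Q0 \<in> P" and Q0_max: "\<And>Q. Q \<in> P \<Longrightarrow> \<bar>sum f Q\<bar> \<le> \<bar>sum f Q0\<bar>"
begin

text \<open>The links come from \<open>mult_ge\<close>, from the triangle inequality for
  \<open>eigen_clique_sum\<close>, and from maximality of \<open>Q0\<close>. They are kept apart so
  that equality can be traced through each one.\<close>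

lemma eigen_vertex_chain:
  assumes v: "v \<in> verts G"
  shows "(c + k) * \<bar>f v\<bar> \<le> (multiplicity v + k) * \<bar>f v\<bar>"
    and "(multiplicity v + k) * \<bar>f v\<bar> \<le> (\<Sum>Q | Q \<in> P \<and> v \<in> Q. \<bar>sum f Q\<bar>)"
    and "(\<Sum>Q | Q \<in> P \<and> v \<in> Q. \<bar>sum f Q\<bar>) \<le> multiplicity v * \<bar>sum f Q0\<bar>"
proof -
  have c: "c \<le> multiplicity v" by (rule mult_ge[OF v])
  then show "(c + k) * \<bar>f v\<bar> \<le> (multiplicity v + k) * \<bar>f v\<bar>"
    by (intro mult_right_mono) auto
  have "(multiplicity v + k) * \<bar>f v\<bar> = \<bar>\<Sum>Q | Q \<in> P \<and> v \<in> Q. sum f Q\<bar>"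
    using c ck_pos by (simp add: eigen_clique_sum[OF v] abs_mult)
  then show "(multiplicity v + k) * \<bar>f v\<bar> \<le> (\<Sum>Q | Q \<in> P \<and> v \<in> Q. \<bar>sum f Q\<bar>)"
    by (simp add: sum_abs)
  have "(\<Sum>Q | Q \<in> P \<and> v \<in> Q. \<bar>sum f Q\<bar>) \<le> (\<Sum>Q | Q \<in> P \<and> v \<in> Q. \<bar>sum f Q0\<bar>)"
    using Q0_max by (intro sum_mono) auto
  then show "(\<Sum>Q | Q \<in> P \<and> v \<in> Q. \<bar>sum f Q\<bar>) \<le> multiplicity v * \<bar>sum f Q0\<bar>"
    by (simp add: multiplicity_def)
qed

text \<open>The triangle inequality inside \<open>Q0\<close>, followed by the vertex chain summed
  over \<open>Q0\<close>.\<close>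

lemma max_clique_chain:
  "(c + k) * \<bar>sum f Q0\<bar> \<le> (\<Sum>v\<in>Q0. (c + k) * \<bar>f v\<bar>)"
  "(\<Sum>v\<in>Q0. (c + k) * \<bar>f v\<bar>) \<le> (\<Sum>v\<in>Q0. multiplicity v * \<bar>sum f Q0\<bar>)"
  subgoal
    unfolding sum_distrib_left[symmetric] using ck_pos by (intro mult_left_mono) (auto simp: sum_abs)
  subgoal
    using eigen_vertex_chain clique_subset[OF Q0] by (intro sum_mono) (meson order_trans subsetD)
  done

text \<open>If the maximum were 0, the chain at \<open>v\<close> would force
  \<open>f v = 0\<close>.\<close>

lemma max_clique_pos:
  assumes "v \<in> verts G" "f v \<noteq> 0"
  shows "\<bar>sum f Q0\<bar> > 0"
proof -
  have "0 < (c + k) * \<bar>f v\<bar>" using assms ck_pos by simp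
  also have "\<dots> \<le> multiplicity v * \<bar>sum f Q0\<bar>"
    using eigen_vertex_chain[OF assms(1)] by linarith
  finally show ?thesis by (auto simp: zero_less_mult_iff)
qed

lemma max_clique_multiplicity_sum:
  assumes "\<bar>sum f Q0\<bar> > 0"
  shows "c + k \<le> (\<Sum>v\<in>Q0. real (multiplicity v))"
proof -
  have "(c + k) * \<bar>sum f Q0\<bar> \<le> (\<Sum>v\<in>Q0. real (multiplicity v)) * \<bar>sum f Q0\<bar>"
    using max_clique_chain by (simp add: sum_distrib_right)
  then show ?thesis using assms by simp
qed

text \<open>Equality of the sums over \<open>Q0\<close> forces equality at each vertex of
  \<open>Q0\<close>, hence in every link of its chain: the first link gives the multiplicity, the
  last gives maximality of all cliques through \<open>v\<close>.\<close>

lemma max_clique_multiplicity_sum_eq: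
  assumes pos: "\<bar>sum f Q0\<bar> > 0" and eq: "c + k = (\<Sum>v\<in>Q0. real (multiplicity v))"
    and v: "v \<in> Q0"
  shows "multiplicity v = c"
    and "\<And>Q. Q \<in> P \<Longrightarrow> v \<in> Q \<Longrightarrow> \<bar>sum f Q\<bar> = \<bar>sum f Q0\<bar>"
proof -
  have vG: "v \<in> verts G" using v clique_subset[OF Q0] by blast
  note chain = eigen_vertex_chain[OF vG]
  have "(\<Sum>v\<in>Q0. (c + k) * \<bar>f v\<bar>) = (\<Sum>v\<in>Q0. multiplicity v * \<bar>sum f Q0\<bar>)"
    using max_clique_chain unfolding sum_distrib_right[symmetric] eq[symmetric] by linarith
  then have ends: "(c + k) * \<bar>f v\<bar> = multiplicity v * \<bar>sum f Q0\<bar>"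
  proof (rule sum_mono_inv[OF _ _ v finite_clique[OF Q0]])
    fix u assume "u \<in> Q0"
    then show "(c + k) * \<bar>f u\<bar> \<le> multiplicity u * \<bar>sum f Q0\<bar>"
      using eigen_vertex_chain[of u] clique_subset[OF Q0] by force
  qed
  \<comment> \<open>Here \<open>c_pos\<close> yields \<open>f v \<noteq> 0\<close>, so that
    \<open>\<bar>f v\<bar>\<close> cancels from the first link.\<close>
  have "0 < multiplicity v * \<bar>sum f Q0\<bar>"
    using pos mult_ge[OF vG] c_pos by simp
  then have "\<bar>f v\<bar> > 0" using ends ck_pos by (metis zero_less_mult_pos)
  moreover have "(c + k) * \<bar>f v\<bar> = (multiplicity v + k) * \<bar>f v\<bar>" using ends chain by linarith
  ultimately show "multiplicity v = c" by simp
  have "(\<Sum>Q | Q \<in> P \<and> v \<in> Q. \<bar>sum f Q\<bar>) = (\<Sum>Q | Q \<in> P \<and> v \<in> Q. \<bar>sum f Q0\<bar>)"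
    using ends chain by (simp add: multiplicity_def)
  then show "\<bar>sum f Q\<bar> = \<bar>sum f Q0\<bar>" if "Q \<in> P" "v \<in> Q" for Q
    by (rule sum_mono_inv) (use that Q0_max finite_partition in auto)
qed

context
  fixes t :: nat
  assumes card_le: "\<And>Q. Q \<in> P \<Longrightarrow> card Q \<le> t"
    and nonzero: "\<exists>v\<in>verts G. f v \<noteq> 0"
begin

text \<open>Vertices outside \<open>Q0\<close> contribute at least \<open>c\<close> each.
  Differences are taken in the reals, so the last inequality also holds when the graph has fewer
  than \<open>t\<close> vertices.\<close>

lemma max_clique_split:
  "real (total_size P) = (\<Sum>v\<in>Q0. real (multiplicity v)) + (\<Sum>v\<in>verts G - Q0. real (multiplicity v))"
  "(\<Sum>v\<in>verts G - Q0. real c) \<le> (\<Sum>v\<in>verts G - Q0. real (multiplicity v))"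
  "(\<Sum>v\<in>verts G - Q0. real c) = (real (card (verts G)) - card Q0) * c"
  "(real (card (verts G)) - t) * c \<le> (real (card (verts G)) - card Q0) * c"
proof -
  show "real (total_size P) =
    (\<Sum>v\<in>Q0. real (multiplicity v)) + (\<Sum>v\<in>verts G - Q0. real (multiplicity v))"
    unfolding total_size_eq_sum_multiplicity of_nat_sum
    by (subst sum.subset_diff[OF clique_subset[OF Q0] finite_verts]) simp
  show "(\<Sum>v\<in>verts G - Q0. real c) \<le> (\<Sum>v\<in>verts G - Q0. real (multiplicity v))"
    using mult_ge by (intro sum_mono) auto
  have "card Q0 \<le> card (verts G)" by (rule card_mono[OF finite_verts clique_subset[OF Q0]])
  then show "(\<Sum>v\<in>verts G - Q0. real c) = (real (card (verts G)) - card Q0) * c"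
    by (simp add: card_Diff_subset[OF finite_clique[OF Q0] clique_subset[OF Q0]])
  show "(real (card (verts G)) - t) * c \<le> (real (card (verts G)) - card Q0) * c"
    using card_le[OF Q0] by (intro mult_right_mono) auto
qed

lemma max_clique_bound: "k + (real (card (verts G)) - t + 1) * c \<le> total_size P"
proof -
  have "c + k \<le> (\<Sum>v\<in>Q0. real (multiplicity v))"
    using max_clique_pos nonzero max_clique_multiplicity_sum by blast
  then show ?thesis using max_clique_split by (simp add: algebra_simps)
qed

text \<open>All inequalities behind \<open>max_clique_bound\<close> become equalities: inside
  \<open>Q0\<close>, outside \<open>Q0\<close>, and in \<open>card Q0 \<le> t\<close>, where
  \<open>c \<ge> 1\<close> permits cancelling.\<close>

lemma max_clique_bound_eq:
  assumes eq: "k + (real (card (verts G)) - t + 1) * c = total_size P"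
  shows "\<And>v. v \<in> verts G \<Longrightarrow> multiplicity v = c"
    and "card Q0 = t"
    and "\<And>v Q. v \<in> Q0 \<Longrightarrow> Q \<in> P \<Longrightarrow> v \<in> Q \<Longrightarrow> \<bar>sum f Q\<bar> = \<bar>sum f Q0\<bar>"
proof -
  have pos: "\<bar>sum f Q0\<bar> > 0" using max_clique_pos nonzero by blast
  have le: "c + k \<le> (\<Sum>v\<in>Q0. real (multiplicity v))"
    using max_clique_multiplicity_sum[OF pos] .
  have eq': "c + k + (real (card (verts G)) - t) * c = total_size P"
    using eq by (simp add: algebra_simps)
  note split = max_clique_split
  have sum_eq: "c + k = (\<Sum>v\<in>Q0. real (multiplicity v))"
    using le eq' split by linarith
  show "\<bar>sum f Q\<bar> = \<bar>sum f Q0\<bar>" if "v \<in> Q0" "Q \<in> P" "v \<in> Q" for v Q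
    using max_clique_multiplicity_sum_eq(2)[OF pos sum_eq] that by blast
  have "(real (card (verts G)) - t) * c = (real (card (verts G)) - card Q0) * c"
    using le eq' split by linarith
  then show "card Q0 = t" using c_pos by simp
  have outer: "(\<Sum>v\<in>verts G - Q0. real c) = (\<Sum>v\<in>verts G - Q0. real (multiplicity v))"
    using le eq' split by linarith
  show "multiplicity v = c" if v: "v \<in> verts G" for v
  proof (cases "v \<in> Q0")
    case True
    then show ?thesis using max_clique_multiplicity_sum_eq(1)[OF pos sum_eq] by blast
  next
    case False
    have "real c = real (multiplicity v)"
      by (rule sum_mono_inv[OF outer]) (use v False mult_ge in auto)
    then show ?thesis by simp
  qed
qed

end

end

end

section \<open>The bound for one partition, and equality spread by connectedness\<close>

text \<open>Chooses the maximal clique and removes the sign condition on \<open>c + k\<close>. In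
  the equality part \<open>{}\<close> is excluded because its cardinality is not
  \<open>t\<close>.\<close>

lemma total_size_bound:
  fixes f :: "'a \<Rightarrow> real" and k :: real and c t :: nat
  assumes eigen: "\<And>v. v \<in> verts G \<Longrightarrow>
      (\<Sum>w\<in>verts G. if v \<rightarrow>\<^bsub>G\<^esub> w then f w else 0) = k * f v"
    and nonzero: "\<exists>v\<in>verts G. f v \<noteq> 0"
    and mult_ge: "\<And>v. v \<in> verts G \<Longrightarrow> c \<le> multiplicity v"
    and c_pos: "1 \<le> c" and t_pos: "1 \<le> t"
    and card_le: "\<And>Q. Q \<in> P \<Longrightarrow> card Q \<le> t"
  shows "k + (real (card (verts G)) - t + 1) * c \<le> total_size P"
    and "\<lbrakk>k + (real (card (verts G)) - t + 1) * c = total_size P; connected G; {} \<notin> P\<rbrakk>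
      \<Longrightarrow> (\<forall>v\<in>verts G. multiplicity v = c) \<and> (\<forall>Q\<in>P. card Q = t)"
proof -
  let ?bound = "k + (real (card (verts G)) - t + 1) * c"
  \<comment> \<open>With \<open>c + k \<le> 0\<close> the trivial estimate by \<open>c\<close> per
    vertex already beats the bound strictly, so equality cannot occur there.\<close>
  have small: "?bound < total_size P" if "c + k \<le> 0"
  proof -
    have "?bound = c + k + card (verts G) * c - t * c" by (simp add: algebra_simps)
    also have "\<dots> < card (verts G) * c"
    proof -
      have "0 < real t * c" using c_pos t_pos by simp
      then show ?thesis using that by simp
    qed
    also have "card (verts G) * c \<le> total_size P"
      unfolding total_size_eq_sum_multiplicity using sum_bounded_below[of "verts G" c multiplicity] mult_ge
      by (simp del: of_nat_mult)
    finally show ?thesis by simp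
  qed
  obtain v0 where v0: "v0 \<in> verts G" using nonzero by blast
  \<comment> \<open>\<open>c \<ge> 1\<close> puts every vertex into some clique; in particular
    \<open>P\<close> is nonempty and the maximum \<open>Y\<close> exists.\<close>
  have "{Q \<in> P. v \<in> Q} \<noteq> {}" if "v \<in> verts G" for v
    using mult_ge[OF that] c_pos unfolding multiplicity_def by (metis card.empty not_one_le_zero order_trans)
  then have cover: "\<exists>Q\<in>P. v \<in> Q" if "v \<in> verts G" for v using that by blast
  define Y where "Y = Max ((\<lambda>Q. \<bar>sum f Q\<bar>) ` P)"
  have le_Y: "\<bar>sum f Q\<bar> \<le> Y" if "Q \<in> P" for Q
    unfolding Y_def using that finite_partition by simp
  have "Y \<in> (\<lambda>Q. \<bar>sum f Q\<bar>) ` P"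
    unfolding Y_def using cover[OF v0] finite_partition by (intro Max_in) auto
  then obtain Q1 where Q1: "Q1 \<in> P" "\<bar>sum f Q1\<bar> = Y" by blast
  show "?bound \<le> total_size P"
  proof (cases "c + k > 0")
    case True
    show ?thesis
      using max_clique_bound[OF eigen mult_ge c_pos True Q1(1) _ card_le nonzero] le_Y Q1(2) by blast
  qed (use small in auto)
  assume eq: "?bound = total_size P" and conn: "connected G" and ne: "{} \<notin> P"
  have ck: "c + k > 0" using small eq by force
  note max_eq = max_clique_bound_eq[OF eigen mult_ge c_pos ck _ _ card_le nonzero eq]
  have mult: "multiplicity v = c" if "v \<in> verts G" for v
    using max_eq(1)[OF _ _ Q1(1) _ _ that] le_Y Q1(2) by blast
  \<comment> \<open>Any clique attaining \<open>Y\<close> may serve as \<open>Q0\<close>, so the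
    equality lemma applies to each of them and not to \<open>Q1\<close> alone.\<close>
  have spread: "\<bar>sum f Q\<bar> = Y" if "Q' \<in> P" "\<bar>sum f Q'\<bar> = Y" "v \<in> Q'" "Q \<in> P" "v \<in> Q" for Q Q' v
    using max_eq(3)[OF _ _ that(1) _ _ that(3,4,5)] le_Y that(2) by auto
  obtain v1 where v1: "v1 \<in> Q1" using ne Q1(1) by (metis all_not_in_conv)
  \<comment> \<open>Induction along a walk: the clique containing the next edge shares the vertex
    \<open>x\<close> with a maximal clique, so it is maximal too and carries the property on to
    \<open>y\<close>.\<close>
  have max_everywhere: "\<exists>Q\<in>P. v \<in> Q \<and> \<bar>sum f Q\<bar> = Y" if "v1 \<rightarrow>\<^sup>*\<^bsub>G\<^esub> v" for v
    using that
  proof (induction rule: reachable_induct)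
    case base
    show ?case using v1 Q1 by blast
  next
    case (step x y)
    then obtain Q where Q: "Q \<in> P" "x \<in> Q" "\<bar>sum f Q\<bar> = Y" by blast
    obtain Q' where "Q' \<in> P" "{x, y} \<subseteq> Q'"
      using partition \<open>x \<rightarrow>\<^bsub>G\<^esub> y\<close> unfolding clique_partition_def by blast
    then show ?case using spread[OF Q(1,3,2)] by blast
  qed
  have "card Q = t" if Q: "Q \<in> P" for Q
  proof -
    obtain v where v: "v \<in> Q" using ne Q by (metis all_not_in_conv)
    then have "v1 \<rightarrow>\<^sup>*\<^bsub>G\<^esub> v"
      using symmetric_connected_imp_strongly_connected[OF sym_arcs conn] clique_subset Q Q1(1) v1
      by (meson strongly_connectedE subsetD)
    then have "\<bar>sum f Q\<bar> = Y" using max_everywhere spread v Q by blast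
    then show ?thesis using max_eq(2)[OF _ _ Q] le_Y by auto
  qed
  then show "(\<forall>v\<in>verts G. multiplicity v = c) \<and> (\<forall>Q\<in>P. card Q = t)" using mult by blast
qed

end

section \<open>Optimal partitions, isolated vertices and regular graphs\<close>

text \<open>An empty member contains no edge and has size 0, so an optimal partition may be assumed
  to have none, as the equality case requires.\<close>

lemma clique_partition_remove_empty:
  assumes "clique_partition G P"
  shows "clique_partition G (P - {{}})"
  using assms unfolding clique_partition_def by (metis DiffE DiffI empty_iff insert_subset singletonD)

lemma total_size_remove_empty:
  assumes "finite P"
  shows "total_size (P - {{}}) = total_size P"
  unfolding total_size_def using assms by (intro sum.mono_neutral_left) auto

context graph
begin

lemma min_total_size_attained:
  assumes "t \<ge> 2"
  obtains P where "clique_partition G P" "\<And>Q. Q \<in> P \<Longrightarrow> card Q \<le> t" "{} \<notin> P"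
    "total_size P = min_total_size t G"
proof -
  let ?I = "{P. clique_partition G P \<and> (\<forall>Q\<in>P. card Q \<le> t)}"
  have "min_total_size t G \<in> total_size ` ?I"
    unfolding min_total_size_def
    using min_total_size_index_set[OF graph_axioms assms] by (intro Min_in) auto
  then obtain P where P: "clique_partition G P" "\<And>Q. Q \<in> P \<Longrightarrow> card Q \<le> t"
    "total_size P = min_total_size t G" by auto
  interpret clique_partitioned_graph G P by unfold_locales (rule P(1))
  show thesis
  proof (rule that[of "P - {{}}"])
    show "clique_partition G (P - {{}})" by (rule clique_partition_remove_empty[OF P(1)])
    show "total_size (P - {{}}) = min_total_size t G"
      using total_size_remove_empty[OF finite_partition] P(3) by simp
  qed (use P(2) in auto)
qed

lemma min_total_size_le:
  assumes "t \<ge> 2" "clique_partition G P" "\<And>Q. Q \<in> P \<Longrightarrow> card Q \<le> t"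
  shows "min_total_size t G \<le> total_size P"
  unfolding min_total_size_def
  using min_total_size_index_set[OF graph_axioms assms(1)] assms(2,3) by (intro Min_le) auto

lemma min_degree_attained:
  assumes "verts G \<noteq> {}"
  obtains v where "v \<in> verts G" "out_degree G v = min_degree G"
proof -
  have "min_degree G \<in> out_degree G ` verts G"
    unfolding min_degree_def using assms by (intro Min_in) auto
  then show thesis using that by auto
qed

text \<open>A vertex of degree 0 reaches only itself. This isolates the case in which the rounded
  quotient is 0.\<close>

lemma connected_min_degree_0:
  assumes "connected G" "min_degree G = 0"
  obtains v where "verts G = {v}"
proof -
  have sc: "strongly_connected G"
    by (rule symmetric_connected_imp_strongly_connected[OF sym_arcs assms(1)])
  then have "verts G \<noteq> {}" by (auto simp: strongly_connected_def)
  then obtain v where v: "v \<in> verts G" "out_degree G v = 0"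
    using min_degree_attained assms(2) by metis
  have isolated: "\<not> v \<rightarrow>\<^bsub>G\<^esub> w" for w
    using v(2) adj_in_verts[of v w] by (auto simp: out_degree_eq_card_neighbours)
  have "w = v" if "w \<in> verts G" for w
  proof -
    have "v \<rightarrow>\<^sup>*\<^bsub>G\<^esub> w" using sc v(1) that by auto
    then show ?thesis by (cases rule: converse_reachable_cases) (use isolated in auto)
  qed
  then show thesis using that v(1) by blast
qed

text \<open>The constant function 1 is an eigenvector for \<open>d\<close>.\<close>

lemma spectral_radius_regular_ge:
  assumes "verts G \<noteq> {}" "\<And>v. v \<in> verts G \<Longrightarrow> out_degree G v = d"
  shows "real d \<le> graph_spectral_radius G"
  by (rule graph_eigenvalue_spectral_radius(2)[OF assms(1), of "\<lambda>_. 1"])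
    (use assms in \<open>auto simp flip: out_degree_sum\<close>)

lemma single_vertex_extremal:
  assumes t: "t \<ge> 2" and v: "verts G = {v}"
  shows "graph_spectral_radius G = 0" "min_total_size t G = 0"
    "regular_graph G" "has_K_decomposition t G"
proof -
  have no_arcs: "\<not> x \<rightarrow>\<^bsub>G\<^esub> y" for x y
    using adj_in_verts[of x y] adj_not_same v by auto
  then show "graph_spectral_radius G = 0"
    using graph_eigenvalue_spectral_radius(1) v by auto
  \<comment> \<open>The empty family has size 0 and is vacuously a decomposition into cliques of
    size \<open>t\<close>, so both sides of the equivalence hold.\<close>
  have part: "clique_partition G {}"
    using no_arcs by (simp add: clique_partition_def)
  then show "min_total_size t G = 0"
    using min_total_size_le[OF t part] by (simp add: total_size_def)
  show "regular_graph G" using v by (simp add: regular_graph_def)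
  show "has_K_decomposition t G" using part by (auto simp: has_K_decomposition_def)
qed

section \<open>The bound and the equality case for positive minimum degree\<close>

lemma min_total_size_bound:
  fixes t c :: nat and bound :: real
  defines "c \<equiv> nat \<lceil>real (min_degree G) / (real t - 1)\<rceil>"
  defines "bound \<equiv> graph_spectral_radius G + (real (card (verts G)) - t + 1) * c"
  assumes t: "t \<ge> 2" and conn: "connected G" and deg: "min_degree G > 0"
  shows "bound \<le> min_total_size t G"
    and "min_total_size t G = bound \<longleftrightarrow> regular_graph G \<and> has_K_decomposition t G"
proof -
  have ne: "verts G \<noteq> {}"
    using conn symmetric_connected_imp_strongly_connected[OF sym_arcs]
    by (auto simp: strongly_connected_def)
  have c_pos: "1 \<le> c" using t deg by (simp add: c_def Suc_le_eq)
  obtain P where P: "clique_partition G P" "\<And>Q. Q \<in> P \<Longrightarrow> card Q \<le> t" "{} \<notin> P"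
    and min: "total_size P = min_total_size t G"
    using min_total_size_attained[OF t] by blast
  interpret P: clique_partitioned_graph G P by unfold_locales (rule P(1))
  obtain f where f: "\<exists>v\<in>verts G. f v \<noteq> 0"
    "\<And>v. v \<in> verts G \<Longrightarrow>
      (\<Sum>w\<in>verts G. if v \<rightarrow>\<^bsub>G\<^esub> w then f w else 0) = graph_spectral_radius G * f v"
    using graph_eigenvalue_spectral_radius(1)[OF ne] by blast
  have mult_ge: "c \<le> P.multiplicity v" if "v \<in> verts G" for v
    unfolding c_def using P.multiplicity_ge_ceiling[OF t that P(2)] by (simp only: nat_le_iff)
  have t1: "1 \<le> t" using t by simp
  note bounds = P.total_size_bound[OF f(2,1) mult_ge c_pos t1 P(2), unfolded min, folded bound_def]
  show ge: "bound \<le> min_total_size t G" using bounds(1) by blast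
  show "min_total_size t G = bound \<longleftrightarrow> regular_graph G \<and> has_K_decomposition t G"
  proof
    assume "min_total_size t G = bound"
    then have eq: "\<forall>v\<in>verts G. P.multiplicity v = c" "\<forall>Q\<in>P. card Q = t"
      using bounds(2) conn P(3) by auto
    have "out_degree G v = c * t - c" if "v \<in> verts G" for v
      using P.out_degree_eq_multiplicity[OF that] eq that by fastforce
    then show "regular_graph G \<and> has_K_decomposition t G"
      using P(1) eq(2) unfolding regular_graph_def has_K_decomposition_def by blast
  next
    assume reg: "regular_graph G \<and> has_K_decomposition t G"
    then obtain d where d: "\<And>v. v \<in> verts G \<Longrightarrow> out_degree G v = d"
      unfolding regular_graph_def by blast
    obtain R where R: "clique_partition G R" "\<And>Q. Q \<in> R \<Longrightarrow> card Q = t"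
      using reg unfolding has_K_decomposition_def by blast
    interpret R: clique_partitioned_graph G R by unfold_locales (rule R(1))
    have min_deg: "min_degree G = d" using min_degree_attained[OF ne] d by metis
    have deg_eq: "real d = real (R.multiplicity v) * (real t - 1)" if "v \<in> verts G" for v
    proof -
      have "real (R.multiplicity v + d) = real (R.multiplicity v * t)"
        using R.out_degree_eq_multiplicity[OF that R(2)] d[OF that] by simp
      then show ?thesis by (simp add: algebra_simps)
    qed
    \<comment> \<open>By \<open>deg_eq\<close> the quotient of \<open>d\<close> by
      \<open>t - 1\<close> is the integer \<open>R.multiplicity v\<close>, so rounding changes
      nothing.\<close>
    have mult: "R.multiplicity v = c" if "v \<in> verts G" for v
      using deg_eq[OF that] t by (simp add: c_def min_deg)
    have d_eq: "real d = c * (real t - 1)" using deg_eq mult ne by fastforce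
    have "min_total_size t G \<le> total_size R"
      by (rule min_total_size_le[OF t R(1)]) (simp add: R(2))
    also have "\<dots> = card (verts G) * c"
      by (simp add: R.total_size_eq_sum_multiplicity mult)
    finally have "real (min_total_size t G) \<le> real (card (verts G)) * c"
      by (metis of_nat_le_iff of_nat_mult)
    \<comment> \<open>By \<open>d_eq\<close>, \<open>d\<close> is exactly the missing
      \<open>(t - 1) * c\<close>. With \<open>d\<close> at most the spectral radius, the minimum is
      squeezed between \<open>bound\<close> and \<open>bound\<close>.\<close>
    also have "\<dots> = d + (real (card (verts G)) - t + 1) * c"
      by (simp add: d_eq algebra_simps)
    also have "\<dots> \<le> bound"
      unfolding bound_def using spectral_radius_regular_ge[OF ne d] by simp
    finally show "min_total_size t G = bound" using ge by simp
  qed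
qed

end

theorem theorem4p1:
  fixes G :: "('a, 'b) pre_digraph" and t :: nat
  assumes "t \<ge> 2"
    and "graph G"
    and "Digraph_Component.connected G"
  shows "let n = card (verts G);
             bound = graph_spectral_radius G
               + (real n - real t + 1) * of_int \<lceil>real (min_degree G) / (real t - 1)\<rceil>
         in real (min_total_size t G) \<ge> bound \<and>
            (real (min_total_size t G) = bound \<longleftrightarrow> regular_graph G \<and> has_K_decomposition t G)"
proof (cases "min_degree G = 0")
  case True
  interpret graph G by fact
  obtain v where "verts G = {v}" using connected_min_degree_0[OF assms(3) True] by blast
  then show ?thesis using single_vertex_extremal[OF assms(1)] True by simp
next
  case False
  interpret graph G by fact
  \<comment> \<open>Nonnegativity identifies the integer ceiling with the natural number
    \<open>c\<close> of \<open>min_total_size_bound\<close>.\<close>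
  have "0 \<le> real (min_degree G) / (real t - 1)" using assms(1) by simp
  then have "\<lceil>real (min_degree G) / (real t - 1)\<rceil> \<ge> 0" by linarith
  then show ?thesis
    using min_total_size_bound[OF assms(1,3)] False by (simp add: Let_def)
qed

end
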